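(* Let $k$ be a positive integer, let $m=(m_1,m_2)\in\mathbb{N}^2\setminus\{0\}$, and let $S=\{0,m,2m,\ldots,(k-1)m\}\cup\{x\in\mathbb{N}^2\mid x\succeq_{glex}km\}$ be the mult-embedded $\mathbb{N}^2$-semigroup, ordered by $\preceq_{glex}$, with multiplicity $m$ and conductor $km$. Then the minimal system of generators of $S$ is the disjoint union $$\begin{aligned}A=\ &\{m\}\sqcup\big(km,(k+1)m\big)_{\preceq_{glex}}\\&\sqcup\{x\in\mathbb{N}^2\mid(k+1)\pi(m)\leq\pi(x)\leq 2k\pi(m)-1\text{ and }x_2<m_2\}\\&\sqcup\{x\in\mathbb{N}^2\mid(k+1)\pi(m)+1\leq\pi(x)\leq 2k\pi(m)+1\text{ and }x_1<m_1\},\end{aligned}$$ and its embedding dimension is $$\mathrm{e}(S)=\frac{(4k-1)\pi(m)^2+\pi(m)+4m_1}{2}.$$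
   Context: $\mathbb{N}$ contains $0$; $x=(x_1,x_2)$ for $x\in\mathbb{N}^2$, and $\pi(x)=x_1+x_2$. The graded lexicographic order on $\mathbb{N}^2$ is: $x\prec_{glex}y$ iff $\pi(x)<\pi(y)$, or $\pi(x)=\pi(y)$ and $x_1<y_1$. The open interval is $(a,b)_{\preceq_{glex}}=\{x\in\mathbb{N}^2\mid a\prec_{glex}x\prec_{glex}b\}$. The embedding dimension $\mathrm{e}(S)$ is the cardinality of the unique minimal system of generators of the monoid $S$. *)

theory Defs
  imports Complex_Main "HOL-Library.Product_Plus"
begin

definition weight :: "nat \<times> nat \<Rightarrow> nat" where
  "weight x = fst x + snd x"

definition glex_less :: "nat \<times> nat \<Rightarrow> nat \<times> nat \<Rightarrow> bool" where
  "glex_less x y \<longleftrightarrow> weight x < weight y \<or> weight x = weight y \<and> fst x < fst y"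

definition glex_le :: "nat \<times> nat \<Rightarrow> nat \<times> nat \<Rightarrow> bool" where
  "glex_le x y \<longleftrightarrow> glex_less x y \<or> x = y"

definition glex_open_interval :: "nat \<times> nat \<Rightarrow> nat \<times> nat \<Rightarrow> (nat \<times> nat) set" where
  "glex_open_interval a b = {x. glex_less a x \<and> glex_less x b}"

definition nmult :: "nat \<Rightarrow> nat \<times> nat \<Rightarrow> nat \<times> nat" where
  "nmult j x = (j * fst x, j * snd x)"

definition is_submonoid :: "'a::comm_monoid_add set \<Rightarrow> bool" where
  "is_submonoid T \<longleftrightarrow> 0 \<in> T \<and> (\<forall>x\<in>T. \<forall>y\<in>T. x + y \<in> T)"

definition minimal_generating_system :: "'a::comm_monoid_add set \<Rightarrow> 'a set \<Rightarrow> bool" where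
  "minimal_generating_system S A \<longleftrightarrow>
     is_submonoid hull A = S \<and> (\<forall>B. B \<subset> A \<longrightarrow> is_submonoid hull B \<noteq> S)"

(* Meaningful only when the minimal generating system exists and is unique. *)
definition embedding_dimension :: "'a::comm_monoid_add set \<Rightarrow> nat" where
  "embedding_dimension S = card (THE A. minimal_generating_system S A)"

end

theory Submission imports Defs begin

text \<open>
  Since the weight is additive and vanishes only at 0, every submonoid of \<open>\<nat>\<^sup>2\<close> is generated by its
  atoms, and every generating set contains them; so the minimal system of generators is the set of
  atoms. Write \<open>p = \<pi>(m)\<close>. An element \<open>x\<close> above \<open>(k+1)m\<close> decomposes as \<open>m + (x - m)\<close> when \<open>m\<close> is
  componentwise below \<open>x\<close>. Otherwise both summands of a decomposition lie above \<open>km\<close>; if \<open>x\<^sub>2 < m\<^sub>2\<close>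
  such a decomposition exists iff \<open>\<pi>(x) \<ge> 2kp\<close>, with \<open>(kp, 0)\<close> as a summand, and if \<open>x\<^sub>1 < m\<^sub>1\<close> iff
  \<open>\<pi>(x) \<ge> 2kp + 2\<close>, with \<open>(0, kp + 1)\<close> as a summand, because then both summands have first
  coordinate below \<open>km\<^sub>1\<close> and hence weight at least \<open>kp + 1\<close>.
\<close>

definition atoms :: "'a::comm_monoid_add set \<Rightarrow> 'a set" where
  "atoms S = {x\<in>S. x \<noteq> 0 \<and> (\<forall>y\<in>S. \<forall>z\<in>S. x = y + z \<longrightarrow> y = 0 \<or> z = 0)}"

definition mult_embedded :: "nat \<Rightarrow> nat \<times> nat \<Rightarrow> (nat \<times> nat) set" where
  "mult_embedded k m = {nmult j m | j. j < k} \<union> {x. glex_le (nmult k m) x}"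

text \<open>The strip along the horizontal axis, empty for \<open>k = 1\<close>. The truncated
  subtraction is exact once \<open>k > 0\<close> and \<open>m \<noteq> 0\<close>.\<close>

definition bottom_atoms :: "nat \<Rightarrow> nat \<times> nat \<Rightarrow> (nat \<times> nat) set" where
  "bottom_atoms k m =
    {x. (k + 1) * weight m \<le> weight x \<and> weight x \<le> 2 * k * weight m - 1 \<and> snd x < snd m}"

definition left_atoms :: "nat \<Rightarrow> nat \<times> nat \<Rightarrow> (nat \<times> nat) set" where
  "left_atoms k m =
    {x. (k + 1) * weight m + 1 \<le> weight x \<and> weight x \<le> 2 * k * weight m + 1 \<and> fst x < fst m}"

lemma weight_add: "weight (x + y) = weight x + weight y"
  by (simp add: weight_def)

lemma weight_nmult: "weight (nmult j m) = j * weight m"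
  by (simp add: weight_def nmult_def algebra_simps)

lemma weight_eq_0_iff: "weight x = 0 \<longleftrightarrow> x = 0"
  by (cases x) (auto simp: weight_def zero_prod_def)

subsection \<open>Minimal generating systems and atoms\<close>

text \<open>Submonoids are closed under arbitrary intersections.\<close>

lemma is_submonoid_hull: "is_submonoid (is_submonoid hull A)"
  by (rule hull_in) (auto simp: is_submonoid_def)

text \<open>Strong induction on the weight: a nonzero non-atom splits into two nonzero elements of
  \<open>S\<close>, both of smaller weight.\<close>

lemma hull_atoms:
  fixes S :: "(nat \<times> nat) set"
  assumes "is_submonoid S"
  shows "is_submonoid hull atoms S = S"
proof
  show "is_submonoid hull atoms S \<subseteq> S"
    by (rule hull_minimal) (use assms in \<open>auto simp: atoms_def\<close>)
  have "x \<in> S \<Longrightarrow> x \<in> is_submonoid hull atoms S" for x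
  proof (induction "weight x" arbitrary: x rule: less_induct)
    case less
    show ?case
    proof (cases "x = 0 \<or> x \<in> atoms S")
      case True
      then show ?thesis
        using is_submonoid_hull[of "atoms S"] hull_subset[of "atoms S" is_submonoid]
        by (auto simp: is_submonoid_def)
    next
      case False
      then obtain y z where yz: "y \<in> S" "z \<in> S" "x = y + z" "y \<noteq> 0" "z \<noteq> 0"
        using less.prems by (auto simp: atoms_def)
      have "weight y < weight x" "weight z < weight x"
        using yz weight_eq_0_iff[of y] weight_eq_0_iff[of z] by (simp_all add: weight_add)
      then show ?thesis
        using less.hyps yz is_submonoid_hull[of "atoms S"] by (auto simp: is_submonoid_def)
    qed
  qed
  then show "S \<subseteq> is_submonoid hull atoms S" by blast
qed

text \<open>Removing an atom from \<open>S\<close> leaves a submonoid, so a generating set without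
  that atom would generate too little.\<close>

lemma atoms_subset_generators:
  assumes "is_submonoid hull A = S"
  shows "atoms S \<subseteq> A"
proof
  fix a assume a: "a \<in> atoms S"
  have S: "is_submonoid S" using is_submonoid_hull[of A] assms by simp
  show "a \<in> A"
  proof (rule ccontr)
    assume "a \<notin> A"
    moreover have "A \<subseteq> S" using hull_subset[of A is_submonoid] assms by simp
    moreover have "is_submonoid (S - {a})"
      unfolding is_submonoid_def
    proof (intro conjI ballI)
      show "0 \<in> S - {a}" using S a by (auto simp: is_submonoid_def atoms_def)
      fix x y assume xy: "x \<in> S - {a}" "y \<in> S - {a}"
      \<comment> \<open>If the sum were the atom \<open>a\<close>, one summand would be 0 and the
        other \<open>a\<close>, which has been removed.\<close>
      then have "x + y \<noteq> a" using a unfolding atoms_def by fastforce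
      then show "x + y \<in> S - {a}" using S xy by (auto simp: is_submonoid_def)
    qed
    ultimately have "is_submonoid hull A \<subseteq> S - {a}"
      by (intro hull_minimal) auto
    then show False using a assms by (auto simp: atoms_def)
  qed
qed

text \<open>The atoms form the least generating set, which yields both existence and
  uniqueness.\<close>

lemma minimal_generating_system_iff_atoms:
  fixes S :: "(nat \<times> nat) set"
  assumes "is_submonoid S"
  shows "minimal_generating_system S B \<longleftrightarrow> B = atoms S"
proof
  assume "minimal_generating_system S B"
  then have "is_submonoid hull B = S" "\<not> atoms S \<subset> B"
    using hull_atoms[OF assms] by (auto simp: minimal_generating_system_def)
  then show "B = atoms S" using atoms_subset_generators[of B S] by blast
next
  assume "B = atoms S"
  then show "minimal_generating_system S B"
    using hull_atoms[OF assms] atoms_subset_generators[of _ S]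
    by (auto simp: minimal_generating_system_def)
qed

subsection \<open>The order and the semigroup\<close>

text \<open>Weight and first coordinate together determine a point, so equality is absorbed into the
  weak inequality.\<close>

lemma glex_le_iff:
  "glex_le x y \<longleftrightarrow> weight x < weight y \<or> weight x = weight y \<and> fst x \<le> fst y"
  by (cases x; cases y) (auto simp: glex_le_def glex_less_def weight_def)

lemma not_glex_less_iff: "\<not> glex_less x y \<longleftrightarrow> glex_le y x"
  by (auto simp: glex_le_iff glex_less_def)

lemma glex_le_trans: "glex_le x y \<Longrightarrow> glex_le y z \<Longrightarrow> glex_le x z"
  by (auto simp: glex_le_iff)

lemma glex_le_add_mono: "glex_le x y \<Longrightarrow> glex_le u v \<Longrightarrow> glex_le (x + u) (y + v)"
  by (auto simp: glex_le_iff weight_add)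

lemma glex_le_add: "glex_le x (x + y)"
  by (auto simp: glex_le_iff weight_def)

lemma nmult_add: "nmult (i + j) m = nmult i m + nmult j m"
  by (simp add: nmult_def plus_prod_def algebra_simps)

lemma nmult_Suc: "nmult (Suc k) m = nmult k m + m"
  by (simp add: nmult_def plus_prod_def)

lemma fst_nmult: "fst (nmult j m) = j * fst m"
  by (simp add: nmult_def)

lemma nmult_0: "nmult 0 m = 0"
  by (simp add: nmult_def zero_prod_def)

lemma nmult_1: "nmult (Suc 0) m = m"
  by (simp add: nmult_def)

lemma nmult_mono: "i \<le> j \<Longrightarrow> glex_le (nmult i m) (nmult j m)"
  using nmult_add[of i "j - i" m] glex_le_add by simp

lemma mult_embedded_cases:
  assumes "x \<in> mult_embedded k m"
  obtains j where "j < k" "x = nmult j m" | "glex_le (nmult k m) x"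
  using assms unfolding mult_embedded_def by blast

lemma nmult_in_mult_embedded: "nmult j m \<in> mult_embedded k m"
  using nmult_mono[of k j m] by (cases "j < k") (auto simp: mult_embedded_def)

text \<open>The part above \<open>nmult k m\<close> absorbs every summand; two smaller elements are
  multiples of \<open>m\<close>, and so is their sum.\<close>

lemma is_submonoid_mult_embedded: "is_submonoid (mult_embedded k m)"
  unfolding is_submonoid_def
proof (intro conjI ballI)
  show "0 \<in> mult_embedded k m"
    using nmult_in_mult_embedded[of 0] by (simp add: nmult_0)
next
  fix x y assume x: "x \<in> mult_embedded k m" and y: "y \<in> mult_embedded k m"
  show "x + y \<in> mult_embedded k m"
  proof (cases "glex_le (nmult k m) x \<or> glex_le (nmult k m) y")
    case True
    then have "glex_le (nmult k m) (x + y)"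
      using glex_le_trans glex_le_add[of x y] glex_le_add[of y x] by (metis add.commute)
    then show ?thesis by (simp add: mult_embedded_def)
  next
    case False
    then obtain i j where "x = nmult i m" "y = nmult j m"
      using x y by (meson mult_embedded_cases)
    then show ?thesis
      using nmult_in_mult_embedded[of "i + j" m k] by (simp add: nmult_add)
  qed
qed

text \<open>This is what makes \<open>m\<close> the multiplicity.\<close>

lemma mult_embedded_ge:
  assumes "x \<in> mult_embedded k m" "x \<noteq> 0" "k > 0"
  shows "glex_le m x"
  using assms(1)
proof (cases rule: mult_embedded_cases)
  case (1 j)
  then show ?thesis
    using assms(2) nmult_mono[of 1 j m] by (cases "j = 0") (auto simp: nmult_0 nmult_1)
next
  case 2
  then show ?thesis
    using assms(3) glex_le_trans[OF nmult_mono[of 1 k m]] by (simp add: nmult_1)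
qed

subsection \<open>Atoms of the semigroup\<close>

text \<open>Two nonzero summands would each weigh at least \<open>weight m > 0\<close>, too much for
  a sum equal to \<open>m\<close>.\<close>

lemma multiplicity_is_atom:
  assumes "k > 0" "m \<noteq> 0"
  shows "m \<in> atoms (mult_embedded k m)"
proof -
  have "y = 0 \<or> z = 0"
    if "y \<in> mult_embedded k m" "z \<in> mult_embedded k m" "m = y + z" for y z
  proof (rule ccontr)
    assume "\<not> (y = 0 \<or> z = 0)"
    then have "weight m \<le> weight y" "weight m \<le> weight z"
      using that(1,2) mult_embedded_ge[of _ k m] assms(1) by (fastforce simp: glex_le_iff)+
    then show False
      using assms(2) weight_eq_0_iff[of m] that(3) weight_add[of y z] by simp
  qed
  then show ?thesis
    using nmult_in_mult_embedded[of 1 m k] assms by (auto simp: atoms_def nmult_1)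
qed

lemma nmult_not_atom:
  assumes "m \<noteq> 0" "j \<noteq> 1"
  shows "nmult j m \<notin> atoms (mult_embedded k m)"
proof (cases j)
  case 0
  then show ?thesis by (simp add: atoms_def nmult_0)
next
  case (Suc i)
  have "nmult j m = m + nmult i m"
    using nmult_add[of 1 i m] Suc by (simp add: nmult_1)
  \<comment> \<open>Since \<open>j = Suc i\<close> differs from 1, \<open>i\<close> is
    positive.\<close>
  moreover have "nmult i m \<noteq> 0"
    using assms Suc weight_eq_0_iff[of m] weight_eq_0_iff[of "nmult i m"]
    by (simp add: weight_nmult)
  ultimately show ?thesis
    using assms(1) nmult_in_mult_embedded[of 1 m k] nmult_in_mult_embedded[of i m k]
    by (auto simp: atoms_def nmult_1)
qed

text \<open>A sum of nonzero elements with one summand above the conductor reaches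
  \<open>nmult (k + 1) m\<close>; otherwise it is a multiple of \<open>m\<close>, and none lies
  strictly between consecutive multiples.\<close>

lemma interval_atoms:
  assumes "k > 0" "x \<in> glex_open_interval (nmult k m) (nmult (k + 1) m)"
  shows "x \<in> atoms (mult_embedded k m)"
proof -
  have gt: "glex_less (nmult k m) x" and lt: "glex_less x (nmult (k + 1) m)"
    using assms(2) by (auto simp: glex_open_interval_def)
  have sum_ge: False
    if "glex_le (nmult k m) y" "z \<in> mult_embedded k m" "z \<noteq> 0" "x = y + z" for y z
    using glex_le_add_mono[OF that(1) mult_embedded_ge[OF that(2,3) assms(1)]] that(4) lt
    by (simp add: nmult_Suc flip: not_glex_less_iff)
  have "y = 0 \<or> z = 0"
    if y: "y \<in> mult_embedded k m" and z: "z \<in> mult_embedded k m" and x: "x = y + z" for y z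
  proof (rule ccontr)
    assume nz: "\<not> (y = 0 \<or> z = 0)"
    then have "\<not> glex_le (nmult k m) y" "\<not> glex_le (nmult k m) z"
      using sum_ge y z x add.commute[of y z] by blast+
    then obtain i j where "y = nmult i m" "z = nmult j m"
      using y z by (meson mult_embedded_cases)
    then have "x = nmult (i + j) m" using x by (simp add: nmult_add)
    then show False
      using gt lt nmult_mono[of "i + j" k m] nmult_mono[of "k + 1" "i + j" m]
      by (cases "i + j \<le> k") (auto simp flip: not_glex_less_iff)
  qed
  moreover have "x \<in> mult_embedded k m" using gt by (simp add: mult_embedded_def glex_le_def)
  moreover have "x \<noteq> 0" using gt by (auto simp: glex_less_def weight_def)
  ultimately show ?thesis by (auto simp: atoms_def)
qed

section \<open>Decompositions of elements above \<open>nmult (k + 1) m\<close>\<close>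

lemma above_conductor_nonzero:
  assumes "k > 0" "m \<noteq> 0" "glex_le (nmult k m) x"
  shows "x \<noteq> 0"
proof -
  have "k * weight m > 0" using assms(1,2) weight_eq_0_iff[of m] by simp
  moreover have "k * weight m \<le> weight x" using assms(3) by (auto simp: glex_le_iff weight_nmult)
  ultimately have "weight x \<noteq> 0" by linarith
  then show ?thesis using weight_eq_0_iff[of x] by simp
qed

text \<open>Separates the two kinds of decomposition: those from which a copy of \<open>m\<close>
  can be split off, and those with both summands above the conductor.\<close>

lemma atom_above_iff:
  assumes "k > 0" "m \<noteq> 0" and x: "glex_le (nmult (k + 1) m) x"
  shows "x \<in> atoms (mult_embedded k m) \<longleftrightarrow>
    (fst x < fst m \<or> snd x < snd m) \<and>
    \<not> (\<exists>y z. glex_le (nmult k m) y \<and> glex_le (nmult k m) z \<and> x = y + z)"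
    (is "?L \<longleftrightarrow> ?R")
proof
  note nz = above_conductor_nonzero[OF assms(1,2)]
  assume L: ?L
  have "\<not> (fst m \<le> fst x \<and> snd m \<le> snd x)"
  proof
    assume "fst m \<le> fst x \<and> snd m \<le> snd x"
    \<comment> \<open>The componentwise truncated subtraction is exact here.\<close>
    then have eq: "x = m + (x - m)" by (simp add: prod_eq_iff)
    have "glex_le (nmult k m) (x - m)"
    proof (rule ccontr)
      assume "\<not> ?thesis"
      then have "glex_less (x - m) (nmult k m)" using not_glex_less_iff by blast
      then have "glex_less (m + (x - m)) (nmult (k + 1) m)"
        by (auto simp: glex_less_def weight_add nmult_Suc)
      then show False using x eq by (simp flip: not_glex_less_iff)
    qed
    then have "x - m \<in> mult_embedded k m" "x - m \<noteq> 0"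
      using nz by (auto simp: mult_embedded_def)
    moreover have "m \<in> mult_embedded k m"
      using nmult_in_mult_embedded[of 1] by (simp add: nmult_1)
    ultimately show False using L eq assms(2) unfolding atoms_def by blast
  qed
  moreover have "x \<noteq> y + z" if "glex_le (nmult k m) y" "glex_le (nmult k m) z" for y z
  proof -
    have "y \<in> mult_embedded k m" "z \<in> mult_embedded k m"
      using that by (simp_all add: mult_embedded_def)
    then show ?thesis using L nz that unfolding atoms_def by blast
  qed
  ultimately show ?R unfolding not_le[symmetric] by blast
next
  assume R: ?R
  \<comment> \<open>A summand that is a positive multiple of \<open>m\<close> would force both
    coordinates of \<open>x\<close> to be at least those of \<open>m\<close>.\<close>
  have above: "glex_le (nmult k m) y"
    if y: "y \<in> mult_embedded k m" "y \<noteq> 0" and eq: "x = y + z" for y z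
    using y(1)
  proof (cases rule: mult_embedded_cases)
    case (1 j)
    then have "j \<noteq> 0" using y(2) by (cases "j = 0") (auto simp: nmult_0)
    then have "fst m \<le> fst y" "snd m \<le> snd y" using 1 by (auto simp: nmult_def)
    then show ?thesis using R eq by auto
  qed
  have "y = 0 \<or> z = 0"
    if "y \<in> mult_embedded k m" "z \<in> mult_embedded k m" "x = y + z" for y z
    using R above[of y z] above[of z y] that add.commute[of y z] by blast
  moreover have "x \<in> mult_embedded k m"
    using glex_le_trans[OF nmult_mono x] by (simp add: mult_embedded_def)
  moreover have "x \<noteq> 0"
    using above_conductor_nonzero[OF _ assms(2) x] by simp
  ultimately show ?L by (auto simp: atoms_def)
qed

lemma sum_of_two_above_iff_snd:
  assumes "k > 0" "snd x < snd m"
  shows "(\<exists>y z. glex_le (nmult k m) y \<and> glex_le (nmult k m) z \<and> x = y + z)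
    \<longleftrightarrow> 2 * k * weight m \<le> weight x" (is "?L \<longleftrightarrow> ?R")
proof
  assume ?L
  then obtain y z where yz: "glex_le (nmult k m) y" "glex_le (nmult k m) z" "x = y + z"
    by blast
  then have "k * weight m \<le> weight y" "k * weight m \<le> weight z"
    by (auto simp: glex_le_iff weight_nmult)
  then show ?R by (simp add: yz(3) weight_add)
next
  assume R: ?R
  obtain a b where ab: "nmult k m = (a, b)" "fst m \<le> a" "snd m \<le> b"
    using assms(1) by (auto simp: nmult_def)
  have kw: "k * weight m = a + b"
    using ab(1) weight_nmult[of k m] by (simp add: weight_def)
  \<comment> \<open>\<open>?y\<close> is the largest point of weight \<open>a + b\<close>. If
    \<open>?z\<close> also has this weight, its second coordinate is below \<open>b\<close>, so its
    first exceeds \<open>a\<close>.\<close>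
  let ?y = "(a + b, 0)" and ?z = "(fst x - (a + b), snd x)"
  have "2 * (a + b) \<le> fst x + snd x" using R kw by (simp add: weight_def)
  then have "glex_le (a, b) ?y" "glex_le (a, b) ?z" "x = ?y + ?z"
    using ab assms by (auto simp: glex_le_iff weight_def prod_eq_iff)
  then show ?L using ab(1) by metis
qed

text \<open>The \<open>+ 2\<close> arises because neither summand may tie in weight with
  \<open>nmult k m\<close>: its first coordinate would be too small.\<close>

lemma sum_of_two_above_iff_fst:
  assumes "k > 0" "fst x < fst m"
  shows "(\<exists>y z. glex_le (nmult k m) y \<and> glex_le (nmult k m) z \<and> x = y + z)
    \<longleftrightarrow> 2 * k * weight m + 2 \<le> weight x" (is "?L \<longleftrightarrow> ?R")
proof -
  obtain a b where ab: "nmult k m = (a, b)" "fst m \<le> a" "snd m \<le> b"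
    using assms(1) by (auto simp: nmult_def)
  have kw: "k * weight m = a + b"
    using ab(1) weight_nmult[of k m] by (simp add: weight_def)
  show ?thesis
  proof
    assume ?L
    then show ?R
      using assms ab(2) kw by (auto simp: glex_le_iff weight_def ab(1))
  next
    assume R: ?R
    \<comment> \<open>One unit of weight above the conductor, so that no comparison of first
      coordinates arises.\<close>
    let ?y = "(0, a + b + 1)" and ?z = "(fst x, snd x - (a + b + 1))"
    have "2 * (a + b) + 2 \<le> fst x + snd x" using R kw by (simp add: weight_def)
    then have "glex_le (a, b) ?y" "glex_le (a, b) ?z" "x = ?y + ?z"
      using ab assms by (auto simp: glex_le_iff weight_def prod_eq_iff)
    then show ?L using ab(1) by metis
  qed
qed

text \<open>On a tie in weight, a small second coordinate means a large first one, so
  \<open>x\<close> wins the tie.\<close>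

lemma above_iff_snd:
  assumes "snd x < snd m"
  shows "glex_le (nmult (k + 1) m) x \<longleftrightarrow> (k + 1) * weight m \<le> weight x"
  using assms by (auto simp: glex_le_iff weight_nmult) (auto simp: weight_def nmult_def algebra_simps)

text \<open>Here \<open>x\<close> loses every tie in weight, hence the \<open>+ 1\<close>.\<close>

lemma above_iff_fst:
  assumes "fst x < fst m"
  shows "glex_le (nmult (k + 1) m) x \<longleftrightarrow> (k + 1) * weight m + 1 \<le> weight x"
  using assms by (auto simp: glex_le_iff weight_nmult) (auto simp: nmult_def)

text \<open>The plane is cut at \<open>nmult (k + 1) m\<close>: the strips account for the atoms
  above, \<open>m\<close> and the interval for those below.\<close>

lemma atoms_mult_embedded:
  assumes "k > 0" "m \<noteq> 0"
  shows "atoms (mult_embedded k m) = {m}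
    \<union> glex_open_interval (nmult k m) (nmult (k + 1) m)
    \<union> bottom_atoms k m \<union> left_atoms k m"
    (is "?A = {m} \<union> ?I \<union> ?B \<union> ?C")
proof -
  have pos: "weight m > 0" using assms(2) weight_eq_0_iff[of m] by simp
  have B_above: "glex_le (nmult (k + 1) m) x" if "x \<in> ?B" for x
    using that above_iff_snd by (auto simp: bottom_atoms_def)
  have C_above: "glex_le (nmult (k + 1) m) x" if "x \<in> ?C" for x
    using that above_iff_fst by (auto simp: left_atoms_def)
  have "x \<in> ?A \<longleftrightarrow> x \<in> ?B \<union> ?C" if x: "glex_le (nmult (k + 1) m) x" for x
  proof -
    let ?d = "\<exists>y z. glex_le (nmult k m) y \<and> glex_le (nmult k m) z \<and> x = y + z"
    \<comment> \<open>Positivity lets \<open>linarith\<close> turn the strict bound into the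
      truncated \<open>- 1\<close>.\<close>
    have k2: "0 < 2 * k * weight m" using pos assms(1) by simp
    have "x \<in> ?A \<longleftrightarrow> x \<in> ?B" if snd_less: "snd x < snd m"
    proof -
      have "(k + 1) * weight m \<le> weight x" using x above_iff_snd[OF snd_less] by blast
      moreover have "\<not> ?d \<longleftrightarrow> weight x \<le> 2 * k * weight m - 1"
        unfolding sum_of_two_above_iff_snd[OF assms(1) snd_less] using k2 by linarith
      ultimately show ?thesis
        unfolding bottom_atoms_def using atom_above_iff[OF assms x] snd_less by blast
    qed
    moreover have "x \<in> ?A \<longleftrightarrow> x \<in> ?C" if fst_less: "fst x < fst m"
    proof -
      have "(k + 1) * weight m + 1 \<le> weight x" using x above_iff_fst[OF fst_less] by blast
      moreover have "\<not> ?d \<longleftrightarrow> weight x \<le> 2 * k * weight m + 1"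
        unfolding sum_of_two_above_iff_fst[OF assms(1) fst_less] by linarith
      ultimately show ?thesis
        unfolding left_atoms_def using atom_above_iff[OF assms x] fst_less by blast
    qed
    ultimately show ?thesis
      using atom_above_iff[OF assms x] unfolding bottom_atoms_def left_atoms_def by blast
  qed
  moreover have "x \<in> ?A \<longleftrightarrow> x \<in> {m} \<union> ?I" if x: "\<not> glex_le (nmult (k + 1) m) x" for x
  proof
    assume A: "x \<in> ?A"
    have lt: "glex_less x (nmult (k + 1) m)" using x not_glex_less_iff by blast
    have "x \<in> mult_embedded k m" using A by (simp add: atoms_def)
    then show "x \<in> {m} \<union> ?I"
    proof (cases rule: mult_embedded_cases)
      case (1 j)
      then show ?thesis using A nmult_not_atom[OF assms(2)] nmult_1 by (cases "j = 1") auto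
    next
      case 2
      \<comment> \<open>The conductor itself can be an atom only for \<open>k = 1\<close>, where it
        equals \<open>m\<close>.\<close>
      then have "x = nmult k m \<or> x \<in> ?I"
        using lt by (auto simp: glex_open_interval_def glex_le_def)
      then show ?thesis
        using A nmult_not_atom[OF assms(2), of k k] nmult_1 by (cases "k = 1") auto
    qed
  qed (use multiplicity_is_atom[OF assms] interval_atoms[OF assms(1)] in blast)
  moreover have "x \<notin> {m} \<union> ?I" if x: "glex_le (nmult (k + 1) m) x" for x
  proof -
    have "glex_less m (nmult (k + 1) m)"
      using assms(1) pos by (simp add: glex_less_def weight_nmult)
    then show ?thesis
      using x not_glex_less_iff[of x "nmult (k + 1) m"] by (auto simp: glex_open_interval_def)
  qed
  ultimately show ?thesis using B_above C_above by blast
qed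

section \<open>Disjointness of the four families\<close>

lemma multiplicity_notin_interval:
  assumes "k > 0"
  shows "m \<notin> glex_open_interval (nmult k m) c"
  using nmult_mono[of 1 k m] assms
  by (auto simp: glex_open_interval_def nmult_1 simp flip: not_glex_less_iff)

lemma multiplicity_notin_bottom_atoms: "k > 0 \<Longrightarrow> m \<noteq> 0 \<Longrightarrow> m \<notin> bottom_atoms k m"
  and multiplicity_notin_left_atoms: "m \<notin> left_atoms k m"
  by (simp_all add: bottom_atoms_def left_atoms_def)

text \<open>The strip lies above \<open>nmult (k + 1) m\<close>, where the interval ends; the same
  holds for the other strip.\<close>

lemma interval_Int_bottom_atoms:
  "glex_open_interval a (nmult (k + 1) m) \<inter> bottom_atoms k m = {}"
  using above_iff_snd[of _ m k]
  by (auto simp: glex_open_interval_def bottom_atoms_def simp flip: not_glex_less_iff)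

lemma interval_Int_left_atoms:
  "glex_open_interval a (nmult (k + 1) m) \<inter> left_atoms k m = {}"
  using above_iff_fst[of _ m k]
  by (auto simp: glex_open_interval_def left_atoms_def simp flip: not_glex_less_iff)

text \<open>A common point would weigh less than \<open>m\<close>, but both strips start at weight
  \<open>(k + 1) * weight m\<close> or more.\<close>

lemma bottom_Int_left_atoms: "bottom_atoms k m \<inter> left_atoms k m = {}"
  by (auto simp: bottom_atoms_def left_atoms_def weight_def)

subsection \<open>Cardinalities\<close>

text \<open>The segment consists of the full antidiagonals of weight \<open>s < weight y\<close>,
  with \<open>s + 1\<close> points each, and \<open>fst y\<close> points of the antidiagonal of
  \<open>y\<close>. Doubling avoids a division.\<close>

lemma card_glex_initial_segment:
  shows "finite {x. glex_less x y}"
    and "2 * card {x. glex_less x y} = weight y * (weight y + 1) + 2 * fst y"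
proof -
  let ?f = "\<lambda>x. (weight x, fst x)"
  let ?T = "Sigma {..<weight y} (\<lambda>s. {..s}) \<union> {weight y} \<times> {..<fst y}"
  have bij: "bij_betw ?f {x. glex_less x y} ?T"
    by (rule bij_betw_byWitness[where f' = "\<lambda>(s, i). (i, s - i)"])
      (auto simp: glex_less_def weight_def)
  show "finite {x. glex_less x y}"
    using bij_betw_finite[OF bij] by simp
  have gauss: "2 * (\<Sum>s<n. Suc s) = n * (n + 1)" for n :: nat
    by (induction n) auto
  have "card ?T = (\<Sum>s<weight y. Suc s) + fst y"
    by (subst card_Un_disjoint) (auto simp: card_SigmaI)
  then show "2 * card {x. glex_less x y} = weight y * (weight y + 1) + 2 * fst y"
    using bij_betw_same_card[OF bij] gauss[of "weight y"] by simp
qed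

lemma glex_open_interval_eq_Diff:
  "glex_open_interval a b = {x. glex_less x b} - insert a {x. glex_less x a}"
  by (auto simp: glex_open_interval_def not_glex_less_iff glex_le_def glex_less_def)
    (auto simp: weight_def prod_eq_iff)

lemma finite_glex_open_interval: "finite (glex_open_interval a b)"
  by (simp add: glex_open_interval_eq_Diff card_glex_initial_segment)

text \<open>The additive form avoids truncated subtraction; the \<open>+ 1\<close> counts the
  endpoint \<open>a\<close>.\<close>

lemma card_glex_open_interval:
  assumes "glex_less a b"
  shows "card (glex_open_interval a b) + card {x. glex_less x a} + 1 = card {x. glex_less x b}"
proof -
  have fin: "finite (insert a {x. glex_less x a})"
    by (simp add: card_glex_initial_segment)
  have sub: "insert a {x. glex_less x a} \<subseteq> {x. glex_less x b}"
    using assms by (auto simp: glex_less_def)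
  have "card (insert a {x. glex_less x a}) = card {x. glex_less x a} + 1"
    using fin by (simp add: glex_less_def)
  then show ?thesis
    using card_Diff_subset[OF fin sub] card_mono[OF card_glex_initial_segment(1) sub]
    by (simp add: glex_open_interval_eq_Diff)
qed

text \<open>In the coordinates weight and \<open>fst\<close> the strip is a rectangle: by
  \<open>c \<le> a\<close>, each antidiagonal involved has all \<open>c\<close> admissible
  points.\<close>

lemma card_weight_strip_fst:
  assumes "c \<le> a"
  shows "finite {x. a \<le> weight x \<and> weight x < b \<and> fst x < c}"
    and "card {x. a \<le> weight x \<and> weight x < b \<and> fst x < c} = (b - a) * c"
proof -
  let ?f = "\<lambda>x. (weight x, fst x)"
  have bij: "bij_betw ?f {x. a \<le> weight x \<and> weight x < b \<and> fst x < c} ({a..<b} \<times> {..<c})"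
    by (rule bij_betw_byWitness[where f' = "\<lambda>(s, i). (i, s - i)"])
      (use assms in \<open>auto simp: weight_def\<close>)
  show "finite {x. a \<le> weight x \<and> weight x < b \<and> fst x < c}"
    using bij_betw_finite[OF bij] by simp
  show "card {x. a \<le> weight x \<and> weight x < b \<and> fst x < c} = (b - a) * c"
    using bij_betw_same_card[OF bij] by (simp add: card_cartesian_product)
qed

lemma card_weight_strip_snd:
  assumes "c \<le> a"
  shows "finite {x. a \<le> weight x \<and> weight x < b \<and> snd x < c}"
    and "card {x. a \<le> weight x \<and> weight x < b \<and> snd x < c} = (b - a) * c"
proof -
  let ?X = "{x. a \<le> weight x \<and> weight x < b \<and> fst x < c}"
  have eq: "{x. a \<le> weight x \<and> weight x < b \<and> snd x < c} = prod.swap ` ?X"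
    by (force simp: weight_def image_iff)
  show "finite {x. a \<le> weight x \<and> weight x < b \<and> snd x < c}"
    unfolding eq using card_weight_strip_fst(1)[OF assms] by simp
  show "card {x. a \<le> weight x \<and> weight x < b \<and> snd x < c} = (b - a) * c"
    unfolding eq using card_weight_strip_fst(2)[OF assms] by (simp add: card_image)
qed

text \<open>Difference of two initial segments; the \<open>+ 2\<close> is the doubled lower
  endpoint.\<close>

lemma card_conductor_interval:
  assumes "m \<noteq> 0"
  shows "2 * card (glex_open_interval (nmult k m) (nmult (k + 1) m))
      + (k * weight m * (k * weight m + 1) + 2 * (k * fst m)) + 2
    = (k + 1) * weight m * ((k + 1) * weight m + 1) + 2 * ((k + 1) * fst m)"
proof -
  have "glex_less (nmult k m) (nmult (k + 1) m)"
    using assms weight_eq_0_iff[of m] by (simp add: glex_less_def weight_nmult)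
  then show ?thesis
    using card_glex_open_interval[of "nmult k m" "nmult (k + 1) m"]
      card_glex_initial_segment(2)[of "nmult k m"] card_glex_initial_segment(2)[of "nmult (k + 1) m"]
    unfolding weight_nmult fst_nmult by linarith
qed

lemma card_bottom_atoms:
  assumes "k > 0" "m \<noteq> 0"
  shows "finite (bottom_atoms k m)" "card (bottom_atoms k m) = (k - 1) * weight m * snd m"
proof -
  have "0 < 2 * k * weight m" using assms weight_eq_0_iff[of m] by simp
  then have eq: "bottom_atoms k m =
      {x. (k + 1) * weight m \<le> weight x \<and> weight x < 2 * k * weight m \<and> snd x < snd m}"
    unfolding bottom_atoms_def by (intro Collect_cong) linarith
  have snd_le: "snd m \<le> (k + 1) * weight m" by (simp add: weight_def)
  \<comment> \<open>The number of antidiagonals in the strip, each contributing \<open>snd m\<close>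
    points.\<close>
  have len: "2 * k * weight m - (k + 1) * weight m = (k - 1) * weight m"
    using assms(1) by (cases k) simp_all
  show "finite (bottom_atoms k m)" "card (bottom_atoms k m) = (k - 1) * weight m * snd m"
    unfolding eq using card_weight_strip_snd[OF snd_le] len by simp_all
qed

lemma card_left_atoms:
  assumes "k > 0"
  shows "finite (left_atoms k m)" "card (left_atoms k m) = ((k - 1) * weight m + 1) * fst m"
proof -
  have eq: "left_atoms k m =
      {x. (k + 1) * weight m + 1 \<le> weight x \<and> weight x < 2 * k * weight m + 2 \<and> fst x < fst m}"
    unfolding left_atoms_def by (intro Collect_cong) linarith
  have fst_le: "fst m \<le> (k + 1) * weight m + 1" by (simp add: weight_def)
  have len: "2 * k * weight m + 2 - ((k + 1) * weight m + 1) = (k - 1) * weight m + 1"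
    using assms by (cases k) simp_all
  show "finite (left_atoms k m)" "card (left_atoms k m) = ((k - 1) * weight m + 1) * fst m"
    unfolding eq using card_weight_strip_fst[OF fst_le] len by simp_all
qed

text \<open>Over the reals the differences become exact, and doubling clears the
  denominator.\<close>

lemma card_atoms_mult_embedded:
  assumes "k > 0" "m \<noteq> 0"
  shows "real (card (atoms (mult_embedded k m)))
    = ((4 * real k - 1) * (real (weight m))\<^sup>2 + real (weight m) + 4 * real (fst m)) / 2"
proof -
  let ?I = "glex_open_interval (nmult k m) (nmult (k + 1) m)"
  define p where "p = real (weight m)"
  have p: "p = real (fst m) + real (snd m)" by (simp add: p_def weight_def)
  have c2: "2 * real (card ?I) + (k * p * (k * p + 1) + 2 * (k * fst m)) + 2
      = (real k + 1) * p * ((real k + 1) * p + 1) + 2 * ((real k + 1) * fst m)"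
    using arg_cong[OF card_conductor_interval[OF assms(2), of k], of real]
    unfolding p_def of_nat_add of_nat_mult of_nat_1 of_nat_numeral .
  have k1: "real (k - 1) = real k - 1" using assms(1) by (simp add: of_nat_diff)
  have c34: "real (card (bottom_atoms k m)) = (real k - 1) * p * snd m"
      "real (card (left_atoms k m)) = ((real k - 1) * p + 1) * fst m"
    unfolding card_bottom_atoms(2)[OF assms] card_left_atoms(2)[OF assms(1)] of_nat_add of_nat_mult k1
    by (simp_all add: p_def)
  have "card (atoms (mult_embedded k m))
      = 1 + card ?I + card (bottom_atoms k m) + card (left_atoms k m)"
    using finite_glex_open_interval card_bottom_atoms(1)[OF assms] card_left_atoms(1)[OF assms(1)]
      multiplicity_notin_interval[OF assms(1)] multiplicity_notin_bottom_atoms[OF assms]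
      multiplicity_notin_left_atoms interval_Int_bottom_atoms interval_Int_left_atoms
      bottom_Int_left_atoms
    by (simp add: atoms_mult_embedded[OF assms] card_Un_disjoint Int_Un_distrib2)
  then have "2 * real (card (atoms (mult_embedded k m)))
      = 2 + 2 * real (card ?I) + 2 * ((real k - 1) * p * snd m)
        + 2 * (((real k - 1) * p + 1) * fst m)"
    using c34 by simp
  \<comment> \<open>The two strips combine through \<open>fst m + snd m = p\<close>, leaving one
    extra antidiagonal with \<open>fst m\<close> points.\<close>
  also have "\<dots> = 2 + 2 * real (card ?I) + 2 * ((real k - 1) * p * p) + 2 * fst m"
    by (simp add: p algebra_simps)
  \<comment> \<open>By \<open>c2\<close>, twice the interval's size is
    \<open>(2k+1) p^2 + p + 2 fst m - 2\<close>.\<close>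
  also have "\<dots> = (4 * real k - 1) * p\<^sup>2 + p + 4 * real (fst m)"
    using c2 by (simp add: algebra_simps power2_eq_square)
  finally show ?thesis by (simp add: p_def)
qed

text \<open>Uniqueness of the minimal system makes the \<open>THE\<close> denote the set of
  atoms.\<close>

lemma embedding_dimension_eq_card_atoms:
  fixes S :: "(nat \<times> nat) set"
  assumes "is_submonoid S"
  shows "embedding_dimension S = card (atoms S)"
  by (simp add: embedding_dimension_def minimal_generating_system_iff_atoms[OF assms])

text \<open>The equivalence for all \<open>B\<close> expresses existence and uniqueness of the
  minimal system; finiteness shows that \<open>card\<close> does not take its default value 0 for
  infinite sets.\<close>

theorem theorem39:
  fixes k :: nat and m :: "nat \<times> nat"
    and S A\<^sub>1 A\<^sub>2 A\<^sub>3 A\<^sub>4 :: "(nat \<times> nat) set"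
  assumes "k > 0"
    and "m \<noteq> 0"
    and "S = {nmult j m | j. j < k} \<union> {x. glex_le (nmult k m) x}"
    and "A\<^sub>1 = {m}"
    and "A\<^sub>2 = glex_open_interval (nmult k m) (nmult (k + 1) m)"
    and "A\<^sub>3 = {x. (k + 1) * weight m \<le> weight x \<and> weight x \<le> 2 * k * weight m - 1
                  \<and> snd x < snd m}"
    and "A\<^sub>4 = {x. (k + 1) * weight m + 1 \<le> weight x \<and> weight x \<le> 2 * k * weight m + 1
                  \<and> fst x < fst m}"
  shows "(\<forall>B. minimal_generating_system S B \<longleftrightarrow> B = A\<^sub>1 \<union> A\<^sub>2 \<union> A\<^sub>3 \<union> A\<^sub>4)
    \<and> disjnt A\<^sub>1 A\<^sub>2 \<and> disjnt A\<^sub>1 A\<^sub>3 \<and> disjnt A\<^sub>1 A\<^sub>4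
    \<and> disjnt A\<^sub>2 A\<^sub>3 \<and> disjnt A\<^sub>2 A\<^sub>4 \<and> disjnt A\<^sub>3 A\<^sub>4
    \<and> finite (A\<^sub>1 \<union> A\<^sub>2 \<union> A\<^sub>3 \<union> A\<^sub>4)
    \<and> real (embedding_dimension S) =
        ((4 * real k - 1) * (real (weight m))\<^sup>2 + real (weight m) + 4 * real (fst m)) / 2"
  unfolding assms(3-7) mult_embedded_def[symmetric] bottom_atoms_def[symmetric]
    left_atoms_def[symmetric] atoms_mult_embedded[OF assms(1,2), symmetric]
    minimal_generating_system_iff_atoms[OF is_submonoid_mult_embedded]
    embedding_dimension_eq_card_atoms[OF is_submonoid_mult_embedded]
    card_atoms_mult_embedded[OF assms(1,2)] disjnt_def
  using multiplicity_notin_interval[OF assms(1)] multiplicity_notin_bottom_atoms[OF assms(1,2)]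
    multiplicity_notin_left_atoms interval_Int_bottom_atoms interval_Int_left_atoms
    bottom_Int_left_atoms card_bottom_atoms(1)[OF assms(1,2)] card_left_atoms(1)[OF assms(1)]
    finite_glex_open_interval
  by (simp add: atoms_mult_embedded[OF assms(1,2)])

end
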